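(* Let $k\ge 0$ and let $L$ be a $k$-DCFL. Then there is a number $n$ such that every word $w\in L$ with $|w|>n$ can be written as $$w=s_0\,y_1u_1z_1\,s_1\,y_2u_2z_2\,s_2\cdots y_lu_lz_l\,s_l$$ for some $l\le k+1$ and words $s_i,y_i,u_i,z_i\in\Sigma^*$, such that: (1) $|y_1z_1\cdots y_lz_l|>0$; (2) $|y_1u_1z_1\cdots y_lu_lz_l|\le n$; (3) for every natural number $p$, the word $s_0y_1^pu_1z_1^ps_1\cdots y_l^pu_lz_l^ps_l$ belongs to $L$.
   Context: Let $\Sigma$ be a finite alphabet and $1\notin\Sigma$ a distinguished separator; $\Sigma_1=\Sigma\cup\{1\}$. The rank of $w\in\Sigma_1^*$ is $\mathrm{rk}(w)=|w|_1$. For $u,v\in\Sigma_1^*$ with $\mathrm{rk}(u)\ge j$, the $j$-th intercalation $u\odot_j v$ is the word obtained from $u$ by replacing the $j$-th occurrence of $1$ by $v$. Let $N$ be a finite set of nonterminals with a rank function $\mathrm{rk}:N\to\{0,\dots,k\}$. The set $Tm_k$ of $k$-correct terms, each with a rank, is the smallest set such that: each $A\in N$ is a term of rank $\mathrm{rk}(A)$; each $w\in\Sigma^*$ is a term of rank $0$; $1$ is a term of rank $1$; if $\alpha,\beta\in Tm_k$ and $\mathrm{rk}(\alpha)+\mathrm{rk}(\beta)\le k$ then $(\alpha\cdot\beta)$ is a term of rank $\mathrm{rk}(\alpha)+\mathrm{rk}(\beta)$; if $1\le j\le k$, $\mathrm{rk}(\alpha)\ge j$ and $\mathrm{rk}(\alpha)+\mathrm{rk}(\beta)\le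 k+1$ then $(\alpha\odot_j\beta)$ is a term of rank $\mathrm{rk}(\alpha)+\mathrm{rk}(\beta)-1$. A term is ground if it contains no nonterminal; its value is the word of $\Sigma_1^*$ obtained by interpreting $\cdot$ as concatenation and $\odot_j$ as $j$-th intercalation. A context $C[x]$ is a term in which a variable $x$ of fixed rank occurs exactly once as a leaf; $C[\beta]$ denotes the substitution of a term $\beta$ of the same rank for $x$. A $k$-displacement context-free grammar ($k$-DCFG) is $G=\langle N,\Sigma,P,S\rangle$ with $S\in N$, $\mathrm{rk}(S)=0$, and $P$ a finite set of rules $A\to\alpha$ with $A\in N$, $\alpha\in Tm_k$, $\mathrm{rk}(A)=\mathrm{rk}(\alpha)$. Derivability $\vdash_G$ is the smallest reflexive transitive relation between nonterminals and terms such that $(B\to\beta)\in P$ and $A\vdash_G C[B]$ imply $A\vdash_G C[\beta]$ for every context $C$. $L(G)$ is the set of values of ground terms $\alpha$ with $S\vdash_G\alpha$. A $k$-DCFL is a language of the form $L(G)$ for a $k$-DCFG $G$ (over alphabet $\Sigma$). *)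

theory Defs
  imports Main
begin

datatype 'a sym = Sep | Sy 'a

text \<open>j-th intercalation (j counted from 1): replace the j-th occurrence of Sep in u by v.\<close>
fun intercal :: "nat \<Rightarrow> 'a sym list \<Rightarrow> 'a sym list \<Rightarrow> 'a sym list" where
  "intercal j [] v = []"
| "intercal j (Sep # u) v = (if j = 1 then v @ u else Sep # intercal (j - 1) u v)"
| "intercal j (Sy a # u) v = Sy a # intercal j u v"

definition rank_w :: "'a sym list \<Rightarrow> nat" where
  "rank_w w = length (filter (\<lambda>c. c = Sep) w)"

datatype ('n, 'a) tm =
    NT 'n
  | Wd "'a list"
  | One
  | Conc "('n, 'a) tm" "('n, 'a) tm"
  | Intc nat "('n, 'a) tm" "('n, 'a) tm"

fun trk :: "('n \<Rightarrow> nat) \<Rightarrow> ('n, 'a) tm \<Rightarrow> nat" where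
  "trk rk (NT A) = rk A"
| "trk rk (Wd w) = 0"
| "trk rk One = 1"
| "trk rk (Conc a b) = trk rk a + trk rk b"
| "trk rk (Intc j a b) = trk rk a + trk rk b - 1"

fun correct :: "nat \<Rightarrow> 'n set \<Rightarrow> ('n \<Rightarrow> nat) \<Rightarrow> ('n, 'a) tm \<Rightarrow> bool" where
  "correct k N rk (NT A) = (A \<in> N)"
| "correct k N rk (Wd w) = True"
| "correct k N rk One = True"
| "correct k N rk (Conc a b) =
     (correct k N rk a \<and> correct k N rk b \<and> trk rk a + trk rk b \<le> k)"
| "correct k N rk (Intc j a b) =
     (correct k N rk a \<and> correct k N rk b \<and> 1 \<le> j \<and> j \<le> k \<and> j \<le> trk rk a
      \<and> trk rk a + trk rk b \<le> k + 1)"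

fun ground :: "('n, 'a) tm \<Rightarrow> bool" where
  "ground (NT A) = False"
| "ground (Wd w) = True"
| "ground One = True"
| "ground (Conc a b) = (ground a \<and> ground b)"
| "ground (Intc j a b) = (ground a \<and> ground b)"

fun val :: "('n, 'a) tm \<Rightarrow> 'a sym list" where
  "val (NT A) = []"
| "val (Wd w) = map Sy w"
| "val One = [Sep]"
| "val (Conc a b) = val a @ val b"
| "val (Intc j a b) = intercal j (val a) (val b)"

record ('n, 'a) dcfg =
  Nts :: "'n set"
  rank :: "'n \<Rightarrow> nat"
  Rules :: "('n \<times> ('n, 'a) tm) set"
  Start :: 'n

definition is_dcfg :: "nat \<Rightarrow> ('n, 'a) dcfg \<Rightarrow> bool" where
  "is_dcfg k G \<longleftrightarrow>
     finite (Nts G) \<and> (\<forall>A\<in>Nts G. rank G A \<le> k) \<and>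
     Start G \<in> Nts G \<and> rank G (Start G) = 0 \<and> finite (Rules G) \<and>
     (\<forall>(A, \<alpha>)\<in>Rules G. A \<in> Nts G \<and> correct k (Nts G) (rank G) \<alpha> \<and>
                         rank G A = trk (rank G) \<alpha>)"

inductive step :: "('n \<times> ('n, 'a) tm) set \<Rightarrow> ('n, 'a) tm \<Rightarrow> ('n, 'a) tm \<Rightarrow> bool"
  for P where
  rule: "(B, \<beta>) \<in> P \<Longrightarrow> step P (NT B) \<beta>"
| concL: "step P a a' \<Longrightarrow> step P (Conc a b) (Conc a' b)"
| concR: "step P b b' \<Longrightarrow> step P (Conc a b) (Conc a b')"
| intcL: "step P a a' \<Longrightarrow> step P (Intc j a b) (Intc j a' b)"
| intcR: "step P b b' \<Longrightarrow> step P (Intc j a b) (Intc j a b')"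

definition derives :: "('n, 'a) dcfg \<Rightarrow> 'n \<Rightarrow> ('n, 'a) tm \<Rightarrow> bool" where
  "derives G A \<alpha> \<longleftrightarrow> (step (Rules G))\<^sup>*\<^sup>* (NT A) \<alpha>"

definition lang :: "('n, 'a) dcfg \<Rightarrow> 'a list set" where
  "lang G = {w. \<exists>\<alpha>. ground \<alpha> \<and> derives G (Start G) \<alpha> \<and> val \<alpha> = map Sy w}"

definition is_dcfl :: "nat \<Rightarrow> 'a list set \<Rightarrow> bool" where
  "is_dcfl k L \<longleftrightarrow> (\<exists>G :: (nat, 'a) dcfg. is_dcfg k G \<and> L = lang G)"

end

theory Submission
  imports Defs
begin

text \<open>Induction on the maximal rank \<open>K\<close> occurring in derivations. A connected region of rank
  \<open>K\<close> nodes in a derivation tree only contains even steps: each of them extends the \<open>K + 1\<close>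
  segments of its argument on both sides but never merges two of them. If a nonterminal is repeated
  on a path through such a region, we obtain an even pump with \<open>K + 1\<close> segments, and it is
  short if taken as low as possible. Otherwise the regions have bounded height. Now a region can
  only be left upwards by filling one of its gaps with a word \<open>b\<close> of rank \<open>0\<close>, and by
  associativity this \<open>b\<close> can be pushed down to the place where the gap was created. This
  rearranges the derivation into one of smaller rank, over the new nonterminals
  \<open>X \<odot>\<^sub>j B\<close>, and the induction hypothesis applies.

  Nonterminals are represented by the languages that they generate: the languages obtained from a
  finite family by boundedly many intercalations again form a finite family of the same type.\<close>

section \<open>Ranks and intercalation\<close>

type_synonym 'a word = "'a sym list"

lemma rank_w_simps [simp]:
  "rank_w [] = 0"
  "rank_w (Sep # w) = Suc (rank_w w)"
  "rank_w (Sy a # w) = rank_w w"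
  "rank_w (u @ v) = rank_w u + rank_w v"
  "rank_w (map Sy x) = 0"
  by (auto simp: rank_w_def filter_empty_conv)

fun letters :: "'a word \<Rightarrow> 'a list" where
  "letters [] = []"
| "letters (Sep # w) = letters w"
| "letters (Sy a # w) = a # letters w"

lemma letters_append [simp]: "letters (u @ v) = letters u @ letters v"
  by (induction u rule: letters.induct) auto

lemma letters_map_Sy [simp]: "letters (map Sy x) = x"
  by (induction x) auto

lemma map_Sy_letters: "rank_w w = 0 \<Longrightarrow> map Sy (letters w) = w"
  by (induction w rule: letters.induct) auto

lemma split_at_Sep:
  assumes "1 \<le> j" "j \<le> rank_w w"
  obtains w1 w2 where "w = w1 @ Sep # w2" "Suc (rank_w w1) = j"
proof -
  have "\<exists>w1 w2. w = w1 @ Sep # w2 \<and> Suc (rank_w w1) = j"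
    using assms
  proof (induction w rule: rev_induct)
    case (snoc c w)
    show ?case
    proof (cases "j \<le> rank_w w")
      case True
      then obtain w1 w2 where "w = w1 @ Sep # w2" "Suc (rank_w w1) = j"
        using snoc by blast
      then have "w @ [c] = w1 @ Sep # (w2 @ [c]) \<and> Suc (rank_w w1) = j" by simp
      then show ?thesis by blast
    next
      case False
      then have "c = Sep" "Suc (rank_w w) = j" using snoc.prems by (cases c; simp)+
      then show ?thesis by blast
    qed
  qed simp
  then show thesis using that by blast
qed

lemma rank_w_eq_1E:
  assumes "rank_w w = 1"
  obtains x y where "w = map Sy x @ Sep # map Sy y"
proof -
  obtain w1 w2 where split: "w = w1 @ Sep # w2" "Suc (rank_w w1) = 1"
    using assms by (metis order_refl split_at_Sep)
  then have "map Sy (letters w1) = w1" "map Sy (letters w2) = w2"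
    using assms by (auto intro: map_Sy_letters)
  then show thesis using split(1) that by metis
qed

lemma intercal_outside: "\<not> (1 \<le> j \<and> j \<le> rank_w u) \<Longrightarrow> intercal j u v = u"
proof (induction j u v rule: intercal.induct)
  case (2 j u v)
  then have "\<not> (1 \<le> j - 1 \<and> j - 1 \<le> rank_w u)" "j \<noteq> 1" by auto
  then show ?case using 2 by simp
qed auto

lemma intercal_append:
  "intercal j (u @ v) w =
    (if j \<le> rank_w u then intercal j u w @ v else u @ intercal (j - rank_w u) v w)"
proof (induction j u w rule: intercal.induct)
  case (2 j u w)
  then show ?case by (cases "j = 0") (auto simp: intercal_outside)
qed (auto simp: intercal_outside)

lemma intercal_map_Sy_append [simp]: "intercal j (map Sy x @ u) v = map Sy x @ intercal j u v"
  by (induction x) auto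

lemma intercal_at_Sep: "Suc (rank_w u1) = j \<Longrightarrow> intercal j (u1 @ Sep # u2) v = u1 @ v @ u2"
  by (auto simp: intercal_append)

lemma intercal_Sep [simp]: "intercal j u [Sep] = u"
  by (induction j u "[Sep] :: 'a word" rule: intercal.induct) auto

lemma rank_w_intercal:
  "1 \<le> j \<Longrightarrow> j \<le> rank_w u \<Longrightarrow> Suc (rank_w (intercal j u v)) = rank_w u + rank_w v"
  by (erule (1) split_at_Sep) (simp add: intercal_at_Sep)

lemma length_intercal:
  "1 \<le> j \<Longrightarrow> j \<le> rank_w u \<Longrightarrow> Suc (length (intercal j u v)) = length u + length v"
  by (erule (1) split_at_Sep) (simp add: intercal_at_Sep)

lemma intercal_assoc:
  assumes "1 \<le> i" "i \<le> rank_w u" "1 \<le> j" "j \<le> rank_w v"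
  shows "intercal (i + j - 1) (intercal i u v) w = intercal i u (intercal j v w)"
proof -
  obtain u1 u2 where "u = u1 @ Sep # u2" "Suc (rank_w u1) = i"
    using assms(1,2) by (rule split_at_Sep)
  then show ?thesis using assms by (auto simp: intercal_at_Sep intercal_append)
qed

lemma intercal_commute:
  assumes "1 \<le> j" "j < i" "i \<le> rank_w u"
  shows "intercal j (intercal i u v) w = intercal (i + rank_w w - 1) (intercal j u w) v"
proof -
  obtain u1 u2 where split: "u = u1 @ Sep # u2" "Suc (rank_w u1) = i"
    using assms by (metis less_imp_le order_trans split_at_Sep)
  then have "Suc (rank_w (intercal j u1 w)) = i + rank_w w - 1"
    using assms rank_w_intercal[of j u1 w] by simp
  then show ?thesis using split assms by (auto simp: intercal_at_Sep intercal_append)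
qed

section \<open>Concatenation and intercalation as instances of one operation\<close>

datatype oper = Cat | Ins nat

primrec combine :: "oper \<Rightarrow> 'a word \<Rightarrow> 'a word \<Rightarrow> 'a word" where
  "combine Cat u v = u @ v"
| "combine (Ins j) u v = intercal j u v"

primrec neutral :: "oper \<Rightarrow> 'a word" where
  "neutral Cat = []"
| "neutral (Ins j) = [Sep]"

primrec admissible :: "oper \<Rightarrow> nat \<Rightarrow> bool" where
  "admissible Cat r = True"
| "admissible (Ins j) r = (1 \<le> j \<and> j \<le> r)"

primrec consumed_seps :: "oper \<Rightarrow> nat" where
  "consumed_seps Cat = 0"
| "consumed_seps (Ins j) = 1"

lemma rank_w_combine:
  "admissible f (rank_w u) \<Longrightarrow> rank_w (combine f u v) + consumed_seps f = rank_w u + rank_w v"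
  by (cases f) (auto simp: rank_w_intercal)

lemma length_combine:
  "admissible f (rank_w u) \<Longrightarrow> length (combine f u v) + consumed_seps f = length u + length v"
  by (cases f) (auto simp: length_intercal)

lemma consumed_seps_le: "admissible f r \<Longrightarrow> consumed_seps f \<le> r"
  by (cases f) auto

lemma rank_w_le_combine_right: "admissible f (rank_w u) \<Longrightarrow> rank_w v \<le> rank_w (combine f u v)"
  using rank_w_combine[of f u v] consumed_seps_le[of f "rank_w u"] by simp

lemma combine_neutral_right: "combine f u (neutral f) = u"
  by (cases f) auto

lemma combine_neutral_left: "admissible f (rank_w (neutral f)) \<Longrightarrow> combine f (neutral f) v = v"
  by (cases f) auto

lemma consumed_seps_less_length:
  assumes "rank_w w = consumed_seps f" "w \<noteq> neutral f"
  shows "consumed_seps f < length w"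
proof (cases f)
  case Cat
  then show ?thesis using assms by simp
next
  case (Ins j)
  then have "rank_w w = 1" using assms(1) by simp
  then obtain x y where "w = map Sy x @ Sep # map Sy y" by (rule rank_w_eq_1E)
  then show ?thesis using Ins assms(2) by auto
qed

lemma intercal_intercal_cases:
  assumes outer: "1 \<le> m" "m \<le> a" and gap: "1 \<le> j" "Suc j \<le> a + b"
  obtains (left) m' i where "1 \<le> i" "i \<le> a" "1 \<le> m'" "m' \<le> a - 1"
      "\<And>u v w :: 'a word. rank_w u = a \<Longrightarrow> rank_w v = b \<Longrightarrow> rank_w w = 0 \<Longrightarrow>
        intercal j (intercal m u v) w = intercal m' (intercal i u w) v"
    | (right) i where "1 \<le> i" "i \<le> b"
      "\<And>u v w :: 'a word. rank_w u = a \<Longrightarrow> rank_w v = b \<Longrightarrow>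
        intercal j (intercal m u v) w = intercal m u (intercal i v w)"
proof -
  consider (before) "j < m" | (inside) "m \<le> j" "j < m + b" | (after) "m + b \<le> j" by linarith
  then show thesis
  proof cases
    case before
    show thesis
      by (rule left[of j "m - 1"]) (use before outer gap in \<open>auto simp: intercal_commute\<close>)
  next
    case inside
    let ?i = "Suc j - m"
    have index: "1 \<le> ?i" "?i \<le> b" "m + ?i - 1 = j" using inside by auto
    have "intercal j (intercal m u v) w = intercal m u (intercal ?i v w)"
      if "rank_w u = a" "rank_w v = b" for u v w :: "'a word"
      using intercal_assoc[of m u ?i v w] that index outer by simp
    then show thesis by (rule right[OF index(1,2)])
  next
    case after
    let ?i = "Suc j - b"
    have index: "1 \<le> ?i" "?i \<le> a" "m < ?i" "?i + b - 1 = j" using after outer gap by auto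
    have "intercal j (intercal m u v) w = intercal m (intercal ?i u w) v"
      if "rank_w u = a" "rank_w v = b" for u v w :: "'a word"
      using intercal_commute[of m ?i u w v] that index outer by simp
    then show thesis by (intro left[of ?i m]) (use index outer in auto)
  qed
qed

lemma intercal_combine_cases:
  assumes admissible: "admissible f a" and gap: "1 \<le> j" "j + consumed_seps f \<le> a + b"
  obtains (left) g i where "1 \<le> i" "i \<le> a" "admissible g (a - 1)"
      "\<And>u v w :: 'a word. rank_w u = a \<Longrightarrow> rank_w v = b \<Longrightarrow> rank_w w = 0 \<Longrightarrow>
        intercal j (combine f u v) w = combine g (intercal i u w) v"
    | (right) i where "1 \<le> i" "i \<le> b"
      "\<And>u v w :: 'a word. rank_w u = a \<Longrightarrow> rank_w v = b \<Longrightarrow>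
        intercal j (combine f u v) w = combine f u (intercal i v w)"
proof (cases f)
  case Cat
  show thesis
  proof (cases "j \<le> a")
    case True
    show thesis by (rule left[of j Cat]) (use True gap Cat in \<open>auto simp: intercal_append\<close>)
  next
    case False
    show thesis
      by (rule right[of "j - a"]) (use False gap Cat in \<open>auto simp: intercal_append\<close>)
  qed
next
  case (Ins m)
  have "1 \<le> m" "m \<le> a" "1 \<le> j" "Suc j \<le> a + b" using Ins admissible gap by auto
  then show thesis
  proof (cases rule: intercal_intercal_cases[where 'a = 'a])
    case (left m' i)
    then show thesis using that(1)[of i "Ins m'"] Ins by simp
  next
    case (right i)
    then show thesis using that(2)[of i] Ins by simp
  qed
qed

section \<open>Pumpable words\<close>

abbreviation (input) pow :: "nat \<Rightarrow> 'a list \<Rightarrow> 'a list" where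
  "pow p x \<equiv> concat (replicate p x)"

lemma pow_append_commute: "pow p x @ x = x @ pow p x"
  by (induction p) auto

type_synonym 'a block = "'a list \<times> 'a list \<times> 'a list \<times> 'a word"

fun pumped :: "nat \<Rightarrow> 'a word \<Rightarrow> 'a block list \<Rightarrow> 'a word" where
  "pumped p t [] = t"
| "pumped p t ((y, u, z, s) # bs) = t @ map Sy (pow p y @ u @ pow p z) @ pumped p s bs"

fun core :: "'a block list \<Rightarrow> ('a list \<times> 'a list \<times> 'a list) list" where
  "core [] = []"
| "core ((y, u, z, s) # bs) = (y, u, z) # core bs"

definition loop_length :: "('a list \<times> 'a list \<times> 'a list) list \<Rightarrow> nat" where
  "loop_length ts = (\<Sum>(y, u, z)\<leftarrow>ts. length (y @ z))"

definition window_length :: "('a list \<times> 'a list \<times> 'a list) list \<Rightarrow> nat" where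
  "window_length ts = (\<Sum>(y, u, z)\<leftarrow>ts. length (y @ u @ z))"

definition pumpable :: "nat \<Rightarrow> nat \<Rightarrow> 'a word set \<Rightarrow> 'a word \<Rightarrow> bool" where
  "pumpable l n X w \<longleftrightarrow> (\<exists>t bs. length bs \<le> l \<and> w = pumped 1 t bs \<and>
     0 < loop_length (core bs) \<and> window_length (core bs) \<le> n \<and> (\<forall>p. pumped p t bs \<in> X))"

lemma length_core [simp]: "length (core bs) = length bs"
  by (induction bs rule: core.induct) auto

lemma pumped_append_left: "pumped p (v @ t) bs = v @ pumped p t bs"
  by (cases bs) auto

lemma rank_w_pumped: "rank_w (pumped p t bs) = rank_w (pumped q t bs)"
  by (induction p t bs rule: pumped.induct) auto

lemma length_pumped_1:
  "length (pumped 1 t bs) = length (pumped 0 t bs) + loop_length (core bs)"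
  by (induction bs arbitrary: t rule: core.induct) (auto simp: loop_length_def)

lemma window_length_le_pumped_1: "window_length (core bs) \<le> length (pumped 1 t bs)"
proof (induction bs arbitrary: t rule: core.induct)
  case (2 y u z s bs)
  have "window_length (core ((y, u, z, s) # bs)) = length (y @ u @ z) + window_length (core bs)"
    by (simp add: window_length_def)
  also have "\<dots> \<le> length (pumped 1 t ((y, u, z, s) # bs))" using "2.IH"[of s] by simp
  finally show ?case .
qed (simp add: window_length_def)

lemma pumpable_mono:
  assumes "pumpable l n X w" "l \<le> l'" "n \<le> n'"
  shows "pumpable l' n' X w"
  using assms unfolding pumpable_def by (elim exE conjE, intro exI conjI) auto

definition lifts_pumps :: "('a word \<Rightarrow> 'a word) \<Rightarrow> bool" where
  "lifts_pumps g \<longleftrightarrow> (\<forall>t bs. \<exists>t' bs'. core bs' = core bs \<and>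
     (\<forall>p. g (pumped p t bs) = pumped p t' bs'))"

lemma pumpable_lift:
  assumes pumpable: "pumpable l n Y w" and lifts: "lifts_pumps g" and image: "g ` Y \<subseteq> X"
  shows "pumpable l n X (g w)"
proof -
  obtain t bs where blocks: "length bs \<le> l" "w = pumped 1 t bs" "0 < loop_length (core bs)"
    "window_length (core bs) \<le> n" "\<And>p. pumped p t bs \<in> Y"
    using pumpable unfolding pumpable_def by blast
  obtain t' bs' where lifted: "core bs' = core bs" "\<And>p. g (pumped p t bs) = pumped p t' bs'"
    using lifts unfolding lifts_pumps_def by blast
  have "length bs' = length bs" using lifted(1) by (metis length_core)
  moreover have "pumped p t' bs' \<in> X" for p using image blocks(5) lifted(2)[symmetric] by auto
  ultimately show ?thesis
    unfolding pumpable_def using blocks lifted by (intro exI[of _ t'] exI[of _ bs']) auto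
qed

lemma lifts_pumps_comp:
  assumes "lifts_pumps f" "lifts_pumps g"
  shows "lifts_pumps (\<lambda>w. f (g w))"
  using assms unfolding lifts_pumps_def by metis

lemma lifts_pumps_prepend: "lifts_pumps (\<lambda>w. v @ w)"
  unfolding lifts_pumps_def by (metis pumped_append_left)

lemma lifts_pumps_append: "lifts_pumps (\<lambda>w. w @ v)"
proof -
  have "\<exists>t' bs'. core bs' = core bs \<and> (\<forall>p. pumped p t bs @ v = pumped p t' bs')" for t bs
  proof (induction bs arbitrary: t rule: core.induct)
    case 1
    then show ?case by (metis pumped.simps(1))
  next
    case (2 y u z s bs)
    obtain s' bs' where "core bs' = core bs" "\<And>p. pumped p s bs @ v = pumped p s' bs'"
      using "2.IH" by blast
    then show ?case by (intro exI[of _ t] exI[of _ "(y, u, z, s') # bs'"]) simp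
  qed
  then show ?thesis unfolding lifts_pumps_def by blast
qed

lemma lifts_pumps_intercal_left: "lifts_pumps (\<lambda>w. intercal j w v)"
proof -
  have "\<exists>t' bs'. core bs' = core bs \<and> (\<forall>p. intercal j (pumped p t bs) v = pumped p t' bs')" for t bs
  proof (induction bs arbitrary: t j rule: core.induct)
    case 1
    then show ?case by (metis pumped.simps(1))
  next
    case (2 y u z s bs)
    show ?case
    proof (cases "j \<le> rank_w t")
      case True
      then show ?thesis
        by (intro exI[of _ "intercal j t v"] exI[of _ "(y, u, z, s) # bs"])
          (simp add: intercal_append)
    next
      case False
      obtain s' bs' where lifted: "core bs' = core bs"
        "\<And>p. intercal (j - rank_w t) (pumped p s bs) v = pumped p s' bs'"
        using "2.IH" by blast
      have "intercal j (pumped p t ((y, u, z, s) # bs)) v =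
          t @ map Sy (pow p y @ u @ pow p z) @ intercal (j - rank_w t) (pumped p s bs) v" for p
        using False intercal_map_Sy_append[of "j - rank_w t" "pow p y @ u @ pow p z"]
        by (simp add: intercal_append[of _ t])
      then show ?thesis
        using lifted by (intro exI[of _ t] exI[of _ "(y, u, z, s') # bs'"]) simp
    qed
  qed
  then show ?thesis unfolding lifts_pumps_def by blast
qed

lemma lifts_pumps_combine_left: "lifts_pumps (\<lambda>w. combine f w v)"
  by (cases f) (simp_all add: lifts_pumps_append lifts_pumps_intercal_left)

lemma lifts_pumps_combine_right:
  assumes "admissible f (rank_w u)"
  shows "lifts_pumps (combine f u)"
proof (cases f)
  case Cat
  then have "combine f u = (\<lambda>w. u @ w)" by (simp add: fun_eq_iff)
  then show ?thesis using lifts_pumps_prepend by simp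
next
  case (Ins j)
  then have "1 \<le> j" "j \<le> rank_w u" using assms by auto
  then obtain u1 u2 where "u = u1 @ Sep # u2" "Suc (rank_w u1) = j" by (rule split_at_Sep)
  then have "combine f u = (\<lambda>w. u1 @ w @ u2)" using Ins by (simp add: fun_eq_iff intercal_at_Sep)
  then show ?thesis
    using lifts_pumps_comp[OF lifts_pumps_prepend lifts_pumps_append, of u1 u2] by simp
qed

section \<open>Even contexts\<close>

fun join :: "'a list list \<Rightarrow> 'a word" where
  "join [] = []"
| "join [x] = map Sy x"
| "join (x # y # ys) = map Sy x @ Sep # join (y # ys)"

lemma join_Cons: "us \<noteq> [] \<Longrightarrow> join (u # us) = map Sy u @ Sep # join us"
  by (cases us) auto

lemma rank_w_join: "length us = Suc K \<Longrightarrow> rank_w (join us) = K"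
  by (induction us arbitrary: K rule: join.induct) auto

lemma rank_w_eq_joinE:
  assumes "rank_w w = K"
  obtains us where "w = join us" "length us = Suc K"
proof -
  have "\<exists>us. w = join us \<and> length us = Suc (rank_w w)"
  proof (induction w rule: letters.induct)
    case 1
    then show ?case by (intro exI[of _ "[[]]"]) simp
  next
    case (2 w)
    then obtain us where "w = join us" "length us = Suc (rank_w w)" by blast
    then show ?case by (intro exI[of _ "[] # us"]) (auto simp: neq_Nil_conv length_Suc_conv)
  next
    case (3 a w)
    then obtain u us where "w = join (u # us)" "length (u # us) = Suc (rank_w w)"
      by (metis length_Suc_conv)
    then show ?case by (intro exI[of _ "(a # u) # us"]) (cases us; simp)
  qed
  then show thesis using assms that by blast
qed

fun wrap :: "('a list \<times> 'a list) list \<Rightarrow> 'a list list \<Rightarrow> 'a list list" where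
  "wrap ((y, z) # cs) (u # us) = (y @ u @ z) # wrap cs us"
| "wrap _ _ = []"

lemma length_wrap [simp]: "length cs = length us \<Longrightarrow> length (wrap cs us) = length us"
  by (induction cs us rule: wrap.induct) auto

lemma wrap_replicate_Nil: "wrap (replicate (length us) ([], [])) us = us"
  by (induction us) auto

lemma wrap_wrap:
  "length cs = length ds \<Longrightarrow> length ds = length us \<Longrightarrow>
    wrap cs (wrap ds us) = wrap (map2 (\<lambda>(y, z) (y', z'). (y @ y', z' @ z)) cs ds) us"
  by (induction cs ds us rule: list_induct3) auto

lemma length_join_wrap:
  "length cs = length us \<Longrightarrow> length (join us) \<le> length (join (wrap cs us))"
proof (induction cs us rule: wrap.induct)
  case (1 y z cs u us)
  show ?case
  proof (cases "us = []")
    case False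
    then have "wrap cs us \<noteq> []" using 1 by (metis length_wrap length_0_conv length_Cons nat.inject)
    then show ?thesis using 1 False by (simp add: join_Cons)
  qed (use 1 in simp)
qed auto

text \<open>The segments are never merged, so an even context can be iterated segmentwise.\<close>

definition even_ctx :: "nat \<Rightarrow> ('a word \<Rightarrow> 'a word) \<Rightarrow> bool" where
  "even_ctx K f \<longleftrightarrow> (\<exists>cs. length cs = Suc K \<and>
     (\<forall>us. length us = Suc K \<longrightarrow> f (join us) = join (wrap cs us)))"

lemma rank_w_even_ctx: "even_ctx K f \<Longrightarrow> rank_w u = K \<Longrightarrow> rank_w (f u) = K"
  by (erule rank_w_eq_joinE) (auto simp: even_ctx_def rank_w_join)

lemma length_even_ctx: "even_ctx K f \<Longrightarrow> rank_w u = K \<Longrightarrow> length u \<le> length (f u)"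
  by (erule rank_w_eq_joinE) (auto simp: even_ctx_def length_join_wrap)

lemma even_ctx_id: "even_ctx K (\<lambda>w. w)"
  unfolding even_ctx_def
  by (intro exI[of _ "replicate (Suc K) ([], [])"]) (metis length_replicate wrap_replicate_Nil)

lemma even_ctx_comp:
  assumes "even_ctx K f" "even_ctx K g"
  shows "even_ctx K (\<lambda>w. f (g w))"
proof -
  obtain cs where wraps_f: "length cs = Suc K" "\<And>us. length us = Suc K \<Longrightarrow> f (join us) = join (wrap cs us)"
    using assms(1) unfolding even_ctx_def by blast
  obtain ds where wraps_g: "length ds = Suc K" "\<And>us. length us = Suc K \<Longrightarrow> g (join us) = join (wrap ds us)"
    using assms(2) unfolding even_ctx_def by blast
  show ?thesis unfolding even_ctx_def
    by (rule exI[of _ "map2 (\<lambda>(y, z) (y', z'). (y @ y', z' @ z)) cs ds"])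
      (simp add: wraps_f wraps_g wrap_wrap)
qed

lemma even_ctx_0I:
  assumes "\<And>u. f (map Sy u) = map Sy (y @ u @ z)"
  shows "even_ctx 0 f"
  unfolding even_ctx_def
proof (intro exI[of _ "[(y, z)]"] conjI allI impI)
  fix us :: "'a list list"
  assume "length us = Suc 0"
  then obtain u where "us = [u]" by (auto simp: length_Suc_conv)
  then show "f (join us) = join (wrap [(y, z)] us)" using assms by simp
qed simp

lemma even_ctx_SucI:
  assumes "even_ctx K f"
    and step: "\<And>u w. rank_w w = K \<Longrightarrow> g (map Sy u @ Sep # w) = map Sy (y @ u @ z) @ Sep # f w"
  shows "even_ctx (Suc K) g"
proof -
  obtain cs where wraps_f: "length cs = Suc K" "\<And>us. length us = Suc K \<Longrightarrow> f (join us) = join (wrap cs us)"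
    using assms(1) unfolding even_ctx_def by blast
  have "g (join us) = join (wrap ((y, z) # cs) us)" if length_us: "length us = Suc (Suc K)" for us
  proof -
    obtain v vs where segments: "us = v # vs" "length vs = Suc K"
      using length_us by (cases us) auto
    then have "length (wrap cs vs) = Suc K" using wraps_f(1) by simp
    then have "vs \<noteq> []" "wrap cs vs \<noteq> []" using segments by auto
    then show ?thesis using segments wraps_f(2) step by (simp add: join_Cons rank_w_join)
  qed
  then show ?thesis
    unfolding even_ctx_def using wraps_f(1) by (intro exI[of _ "(y, z) # cs"]) auto
qed

lemma even_ctx_prepend: "even_ctx K (\<lambda>w. map Sy x @ w)"
proof (cases K)
  case 0
  show ?thesis unfolding 0 by (rule even_ctx_0I[where y = x and z = "[]"]) simp
next
  case (Suc K')
  show ?thesis unfolding Suc by (rule even_ctx_SucI[OF even_ctx_id, where y = x and z = "[]"]) simp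
qed

lemma even_ctx_append: "even_ctx K (\<lambda>w. w @ map Sy x)"
proof (induction K)
  case 0
  show ?case by (rule even_ctx_0I[where y = "[]" and z = x]) simp
next
  case (Suc K)
  then show ?case by (rule even_ctx_SucI[where y = "[]" and z = "[]"]) simp
qed

lemma even_ctx_intercal:
  assumes "rank_w v = 1" "1 \<le> j" "j \<le> K"
  shows "even_ctx K (\<lambda>w. intercal j w v)"
proof -
  obtain a b where split: "v = map Sy a @ Sep # map Sy b" using assms(1) by (rule rank_w_eq_1E)
  show ?thesis using assms(2,3)
  proof (induction K arbitrary: j)
    case (Suc K)
    show ?case
    proof (cases "j = 1")
      case True
      then show ?thesis
        by (intro even_ctx_SucI[OF even_ctx_prepend[of K b], where y = "[]" and z = a])
          (simp add: split)
    next
      case False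
      then have "even_ctx K (\<lambda>w. intercal (j - 1) w v)" using Suc by auto
      then show ?thesis
        by (rule even_ctx_SucI[where y = "[]" and z = "[]"]) (use False in simp)
    qed
  qed simp
qed

lemma even_ctx_combine_left:
  assumes "rank_w v = consumed_seps f" "admissible f K"
  shows "even_ctx K (\<lambda>w. combine f w v)"
proof (cases f)
  case Cat
  then show ?thesis using even_ctx_append[of K "letters v"] assms by (simp add: map_Sy_letters)
next
  case (Ins j)
  then show ?thesis using even_ctx_intercal[of v j K] assms by simp
qed

lemma even_ctx_combine_right:
  assumes "rank_w u = consumed_seps f" "admissible f (rank_w u)"
  shows "even_ctx K (combine f u)"
proof (cases f)
  case Cat
  then have "combine f u = (\<lambda>w. map Sy (letters u) @ w)"
    using assms by (simp add: fun_eq_iff map_Sy_letters)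
  then show ?thesis using even_ctx_prepend by simp
next
  case (Ins j)
  then have "rank_w u = 1" using assms(1) by simp
  then obtain a b where "u = map Sy a @ Sep # map Sy b" by (rule rank_w_eq_1E)
  then have "combine f u = (\<lambda>w. map Sy a @ (w @ map Sy b))"
    using Ins assms by (simp add: fun_eq_iff)
  then show ?thesis
    using even_ctx_comp[OF even_ctx_prepend[of K a] even_ctx_append[of K b]] by simp
qed

lemma wrap_funpow:
  assumes "length cs = length us"
  shows "(wrap cs ^^ p) us = wrap (map (\<lambda>(y, z). (pow p y, pow p z)) cs) us"
proof (induction p)
  case 0
  then show ?case using assms
    by (induction cs us rule: list_induct2) auto
next
  case (Suc p)
  have "wrap cs (wrap (map (\<lambda>(y, z). (pow p y, pow p z)) cs) us) =
    wrap (map (\<lambda>(y, z). (pow (Suc p) y, pow (Suc p) z)) cs) us"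
    using assms by (induction cs us rule: list_induct2) (auto simp: pow_append_commute)
  then show ?case using Suc by simp
qed

lemma join_wrap_pow_eq_pumped:
  assumes "length cs = length us" "us \<noteq> []"
  shows "\<exists>bs. length bs = length us \<and>
    (\<forall>p. join (wrap (map (\<lambda>(y, z). (pow p y, pow p z)) cs) us) = pumped p [] bs)"
  using assms
proof (induction cs us rule: wrap.induct)
  case (1 y z cs u us)
  show ?case
  proof (cases "us = []")
    case True
    then show ?thesis using 1 by (intro exI[of _ "[(y, u, z, [])]"]) auto
  next
    case False
    let ?W = "\<lambda>p. wrap (map (\<lambda>(y, z). (pow p y, pow p z)) cs) us"
    obtain bs where blocks: "length bs = length us" "\<And>p. join (?W p) = pumped p [] bs"
      using 1 False by auto
    have "length (?W p) = length us" for p using 1 by simp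
    then have "?W p \<noteq> []" for p using False by (metis length_0_conv)
    then have "join (wrap (map (\<lambda>(y, z). (pow p y, pow p z)) ((y, z) # cs)) (u # us)) =
        pumped p [] ((y, u, z, [Sep]) # bs)" for p
      using blocks(2) pumped_append_left[of p "[Sep]" "[]" bs] by (simp add: join_Cons)
    then show ?thesis using blocks(1) by (intro exI[of _ "(y, u, z, [Sep]) # bs"]) simp
  qed
qed auto

lemma pumpable_even_ctx:
  assumes even: "even_ctx K f" and closed: "f ` X \<subseteq> X"
    and grows: "u \<in> X" "rank_w u = K" "length u < length (f u)"
  shows "pumpable (Suc K) (length (f u)) X (f u)"
proof -
  obtain cs where wraps: "length cs = Suc K" "\<And>us. length us = Suc K \<Longrightarrow> f (join us) = join (wrap cs us)"
    using even unfolding even_ctx_def by blast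
  obtain us where segments: "u = join us" "length us = Suc K" using grows(2) by (rule rank_w_eq_joinE)
  have "length ((wrap cs ^^ p) us) = Suc K \<and> (f ^^ p) u = join ((wrap cs ^^ p) us) \<and> (f ^^ p) u \<in> X"
    for p by (induction p) (use segments grows(1) wraps closed in auto)
  then have funpow: "(f ^^ p) u = join ((wrap cs ^^ p) us)" "(f ^^ p) u \<in> X" for p by blast+
  have "length cs = length us" "us \<noteq> []" using wraps(1) segments(2) by auto
  then obtain bs where blocks: "length bs = length us"
    "\<And>p. join (wrap (map (\<lambda>(y, z). (pow p y, pow p z)) cs) us) = pumped p [] bs"
    using join_wrap_pow_eq_pumped by blast
  have pumped: "(f ^^ p) u = pumped p [] bs" for p
    using funpow(1) blocks(2) wrap_funpow \<open>length cs = length us\<close> by metis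
  have "u = pumped 0 [] bs" "f u = pumped 1 [] bs" using pumped[of 0] pumped[of 1] by auto
  then have "0 < loop_length (core bs)" using grows(3) length_pumped_1[of "[]" bs] by simp
  then show ?thesis unfolding pumpable_def
    using blocks(1) segments(2) funpow(2) pumped \<open>f u = pumped 1 [] bs\<close> window_length_le_pumped_1[of bs "[]"]
    by (intro exI[of _ "[]"] exI[of _ bs]) auto
qed

section \<open>Even embeddings\<close>

definition lang_combine :: "oper \<Rightarrow> 'a word set \<Rightarrow> 'a word set \<Rightarrow> 'a word set" where
  "lang_combine f X Y = (\<Union>x\<in>X. combine f x ` Y)"

lemma lang_combineI: "x \<in> X \<Longrightarrow> y \<in> Y \<Longrightarrow> combine f x y \<in> lang_combine f X Y"
  by (auto simp: lang_combine_def)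

lemma pumpable_combine:
  assumes "lang_combine f Y Z \<subseteq> X" "u \<in> Y" "v \<in> Z" "admissible f (rank_w u)"
    and "pumpable l n Y u \<or> pumpable l n Z v"
  shows "pumpable l n X (combine f u v)"
  using assms(5)
proof
  assume "pumpable l n Y u"
  then show ?thesis
    by (rule pumpable_lift[OF _ lifts_pumps_combine_left])
      (use assms(1,3) in \<open>auto simp: lang_combine_def\<close>)
next
  assume "pumpable l n Z v"
  then show ?thesis
    by (rule pumpable_lift[OF _ lifts_pumps_combine_right[OF assms(4)]])
      (use assms(1,2) in \<open>auto simp: lang_combine_def\<close>)
qed

definition embeds_evenly :: "nat \<Rightarrow> 'a word set \<Rightarrow> 'a word \<Rightarrow> 'a word set \<Rightarrow> 'a word \<Rightarrow> bool" where
  "embeds_evenly K Y u X w \<longleftrightarrow> rank_w u = K \<and> u \<in> Y \<and>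
     (\<exists>f. even_ctx K f \<and> f ` Y \<subseteq> X \<and> f u = w)"

lemma embeds_evenly_refl: "rank_w w = K \<Longrightarrow> w \<in> X \<Longrightarrow> embeds_evenly K X w X w"
  unfolding embeds_evenly_def using even_ctx_id by blast

lemma embeds_evenly_trans:
  assumes "embeds_evenly K Z v Y u" "embeds_evenly K Y u X w"
  shows "embeds_evenly K Z v X w"
proof -
  obtain f g where "even_ctx K f" "f ` Z \<subseteq> Y" "f v = u" "even_ctx K g" "g ` Y \<subseteq> X" "g u = w"
    using assms unfolding embeds_evenly_def by blast
  then have "even_ctx K (\<lambda>x. g (f x))" "(\<lambda>x. g (f x)) ` Z \<subseteq> X" "g (f v) = w"
    using even_ctx_comp by auto
  then show ?thesis using assms(1) unfolding embeds_evenly_def by blast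
qed

lemma rank_w_embeds_evenly: "embeds_evenly K Y u X w \<Longrightarrow> rank_w w = K"
  unfolding embeds_evenly_def using rank_w_even_ctx by blast

lemma length_embeds_evenly: "embeds_evenly K Y u X w \<Longrightarrow> length u \<le> length w"
  unfolding embeds_evenly_def using length_even_ctx by blast

lemma pumpable_embeds_evenly:
  assumes "embeds_evenly K X u X w" "length u < length w"
  shows "pumpable (Suc K) (length w) X w"
  using assms pumpable_even_ctx unfolding embeds_evenly_def by blast

lemma embeds_evenly_combine_left:
  assumes "lang_combine f Y Z \<subseteq> X" "u \<in> Y" "v \<in> Z" "admissible f (rank_w u)"
    and "rank_w u = K" "rank_w (combine f u v) = K"
  shows "embeds_evenly K Y u X (combine f u v)"
proof -
  have "rank_w v = consumed_seps f" using rank_w_combine[OF assms(4), of v] assms(5,6) by simp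
  then have "even_ctx K (\<lambda>w. combine f w v)" using assms(4,5) by (auto intro: even_ctx_combine_left)
  then show ?thesis using assms unfolding embeds_evenly_def lang_combine_def by blast
qed

lemma embeds_evenly_combine_right:
  assumes "lang_combine f Y Z \<subseteq> X" "u \<in> Y" "v \<in> Z" "admissible f (rank_w u)"
    and "rank_w v = K" "rank_w (combine f u v) = K"
  shows "embeds_evenly K Z v X (combine f u v)"
proof -
  have "rank_w u = consumed_seps f" using rank_w_combine[OF assms(4), of v] assms(5,6) by simp
  then have "even_ctx K (combine f u)" using assms(4) by (rule even_ctx_combine_right)
  then show ?thesis using assms unfolding embeds_evenly_def lang_combine_def by blast
qed

lemma length_less_combine_left:
  assumes "admissible f (rank_w u)" "rank_w (combine f u v) = rank_w u" "v \<noteq> neutral f"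
  shows "length u < length (combine f u v)"
  using rank_w_combine[of f u v] length_combine[of f u v] consumed_seps_less_length[of v f] assms
  by simp

lemma length_less_combine_right:
  assumes "admissible f (rank_w u)" "rank_w (combine f u v) = rank_w v" "u \<noteq> neutral f"
  shows "length v < length (combine f u v)"
  using rank_w_combine[of f u v] length_combine[of f u v] consumed_seps_less_length[of u f] assms
  by simp

section \<open>Derivations inside a family of languages\<close>

text \<open>The languages in \<open>F\<close> serve as nonterminals, and every inclusion
  between them that has the shape of a production may be used as one. Hence unit
  productions are superfluous, and steps that do not change the word can be excluded without loss
  of generality.\<close>

inductive derivable :: "'a word set set \<Rightarrow> nat \<Rightarrow> nat \<Rightarrow> 'a word set \<Rightarrow> 'a word \<Rightarrow> bool"
  for F c K where
  leaf: "X \<in> F \<Longrightarrow> w \<in> X \<Longrightarrow> length w \<le> c \<Longrightarrow> rank_w w = 0 \<or> w = [Sep] \<Longrightarrow> rank_w w < K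
    \<Longrightarrow> derivable F c K X w"
| node: "X \<in> F \<Longrightarrow> derivable F c K Y u \<Longrightarrow> derivable F c K Z v \<Longrightarrow> lang_combine f Y Z \<subseteq> X
    \<Longrightarrow> admissible f (rank_w u) \<Longrightarrow> u \<noteq> neutral f \<Longrightarrow> v \<noteq> neutral f
    \<Longrightarrow> rank_w (combine f u v) < K \<Longrightarrow> derivable F c K X (combine f u v)"

lemma derivableD:
  assumes "derivable F c K X w"
  shows "X \<in> F" "w \<in> X" "rank_w w < K"
proof -
  have "X \<in> F \<and> w \<in> X \<and> rank_w w < K"
    using assms by induction (auto simp: lang_combine_def)
  then show "X \<in> F" "w \<in> X" "rank_w w < K" by blast+
qed

lemma derivable_mono:
  assumes "derivable F c K Y w" "Y \<subseteq> X" "X \<in> F"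
  shows "derivable F c K X w"
  using assms(1)
proof cases
  case leaf
  then show ?thesis using assms(2,3) by (auto intro: derivable.leaf)
next
  case (node Y' u Z v f)
  then have "lang_combine f Y' Z \<subseteq> X" using assms(2) by blast
  then show ?thesis using node assms(3) by (auto intro: derivable.node)
qed

lemma derivable_combine:
  assumes family: "X \<in> F" and production: "lang_combine f Y Z \<subseteq> X"
    and left: "derivable F c K Y u" and right: "derivable F c K Z v"
    and admissible: "admissible f (rank_w u)" and rank: "rank_w (combine f u v) < K"
  shows "derivable F c K X (combine f u v)"
proof -
  consider (left_neutral) "u = neutral f" | (right_neutral) "v = neutral f"
    | (proper) "u \<noteq> neutral f" "v \<noteq> neutral f" by blast
  then show ?thesis
  proof cases
    case left_neutral
    then have absorb: "combine f u w = w" for w using admissible combine_neutral_left by metis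
    then have "z \<in> X" if "z \<in> Z" for z
      using subsetD[OF production lang_combineI[OF derivableD(2)[OF left] that]] by simp
    then have "Z \<subseteq> X" by blast
    then show ?thesis using derivable_mono[OF right _ family] absorb by simp
  next
    case right_neutral
    then have absorb: "combine f w v = w" for w using combine_neutral_right by metis
    then have "y \<in> X" if "y \<in> Y" for y
      using subsetD[OF production lang_combineI[OF that derivableD(2)[OF right]]] by simp
    then have "Y \<subseteq> X" by blast
    then show ?thesis using derivable_mono[OF left _ family] absorb by simp
  next
    case proper
    then show ?thesis by (intro derivable.node[OF family left right production admissible _ _ rank])
  qed
qed

definition homogeneous :: "'a word set \<Rightarrow> bool" where
  "homogeneous X \<longleftrightarrow> (\<exists>r. \<forall>w\<in>X. rank_w w = r)"

lemma homogeneousD: "homogeneous X \<Longrightarrow> u \<in> X \<Longrightarrow> v \<in> X \<Longrightarrow> rank_w u = rank_w v"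
  unfolding homogeneous_def by metis

lemma homogeneous_lang_combine_Ins:
  assumes "homogeneous X" "homogeneous Y"
  shows "homogeneous (lang_combine (Ins j) X Y)"
proof -
  obtain r q where ranks: "\<And>x. x \<in> X \<Longrightarrow> rank_w x = r" "\<And>y. y \<in> Y \<Longrightarrow> rank_w y = q"
    using assms unfolding homogeneous_def by blast
  have "rank_w (intercal j x y) = (if 1 \<le> j \<and> j \<le> r then r + q - 1 else r)"
    if "x \<in> X" "y \<in> Y" for x y
    using ranks that rank_w_intercal[of j x y] by (auto simp: intercal_outside)
  then show ?thesis unfolding homogeneous_def lang_combine_def by auto
qed

lemma lang_combine_fill_left_subset:
  assumes "lang_combine f Y Z \<subseteq> X"
    and "\<And>y z x. y \<in> Y \<Longrightarrow> z \<in> Z \<Longrightarrow> x \<in> B \<Longrightarrow>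
      intercal j (combine f y z) x = combine g (intercal i y x) z"
  shows "lang_combine g (lang_combine (Ins i) Y B) Z \<subseteq> lang_combine (Ins j) X B"
proof
  fix w
  assume "w \<in> lang_combine g (lang_combine (Ins i) Y B) Z"
  then obtain y x z where factors: "y \<in> Y" "x \<in> B" "z \<in> Z" "w = combine g (intercal i y x) z"
    unfolding lang_combine_def by auto
  then have "w = combine (Ins j) (combine f y z) x" using assms(2) by simp
  moreover have "combine f y z \<in> X" using assms(1) factors(1,3) lang_combineI by blast
  ultimately show "w \<in> lang_combine (Ins j) X B" using factors(2) lang_combineI by metis
qed

lemma lang_combine_fill_right_subset:
  assumes "lang_combine f Y Z \<subseteq> X"
    and "\<And>y z x. y \<in> Y \<Longrightarrow> z \<in> Z \<Longrightarrow> x \<in> B \<Longrightarrow>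
      intercal j (combine f y z) x = combine f y (intercal i z x)"
  shows "lang_combine f Y (lang_combine (Ins i) Z B) \<subseteq> lang_combine (Ins j) X B"
proof
  fix w
  assume "w \<in> lang_combine f Y (lang_combine (Ins i) Z B)"
  then obtain y x z where factors: "y \<in> Y" "x \<in> B" "z \<in> Z" "w = combine f y (intercal i z x)"
    unfolding lang_combine_def by auto
  then have "w = combine (Ins j) (combine f y z) x" using assms(2) by simp
  moreover have "combine f y z \<in> X" using assms(1) factors(1,3) lang_combineI by blast
  ultimately show "w \<in> lang_combine (Ins j) X B" using factors(2) lang_combineI by metis
qed

lemma fill_combine_cases:
  assumes homogeneous: "homogeneous Y" "homogeneous Z" "homogeneous B"
    and members: "u \<in> Y" "v \<in> Z" "b \<in> B" "rank_w b = 0"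
    and production: "lang_combine f Y Z \<subseteq> X" and admissible: "admissible f (rank_w u)"
    and gap: "1 \<le> j" "j \<le> rank_w (combine f u v)"
  obtains (left) g i where "1 \<le> i" "i \<le> rank_w u" "admissible g (rank_w (intercal i u b))"
      "intercal j (combine f u v) b = combine g (intercal i u b) v"
      "lang_combine g (lang_combine (Ins i) Y B) Z \<subseteq> lang_combine (Ins j) X B"
    | (right) i where "1 \<le> i" "i \<le> rank_w v"
      "intercal j (combine f u v) b = combine f u (intercal i v b)"
      "lang_combine f Y (lang_combine (Ins i) Z B) \<subseteq> lang_combine (Ins j) X B"
proof -
  have ranks: "rank_w y = rank_w u" "rank_w z = rank_w v" "rank_w x = 0"
    if "y \<in> Y" "z \<in> Z" "x \<in> B" for y z x
    using that homogeneous members homogeneousD by metis+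
  have "j + consumed_seps f \<le> rank_w u + rank_w v"
    using rank_w_combine[OF admissible, of v] gap(2) by simp
  with admissible gap(1) show thesis
  proof (cases rule: intercal_combine_cases[where 'a = 'a])
    case (left g i)
    have "lang_combine g (lang_combine (Ins i) Y B) Z \<subseteq> lang_combine (Ins j) X B"
      by (rule lang_combine_fill_left_subset[OF production left(4)[OF ranks]])
    moreover have "rank_w (intercal i u b) = rank_w u - 1"
      using rank_w_intercal[OF left(1,2), of b] members(4) by simp
    ultimately show thesis using that(1) left members(4) by simp
  next
    case (right i)
    have "lang_combine f Y (lang_combine (Ins i) Z B) \<subseteq> lang_combine (Ins j) X B"
      by (rule lang_combine_fill_right_subset[OF production right(3)[OF ranks(1,2)]])
    then show thesis using that(2) right by simp
  qed
qed

primrec fill_closure :: "'a word set set \<Rightarrow> nat \<Rightarrow> nat \<Rightarrow> 'a word set set" where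
  "fill_closure F K 0 = F"
| "fill_closure F K (Suc i) =
     fill_closure F K i \<union> (\<Union>j\<le>K. \<Union>X\<in>F. lang_combine (Ins j) X ` fill_closure F K i)"

lemma finite_fill_closure: "finite F \<Longrightarrow> finite (fill_closure F K i)"
  by (induction i) auto

lemma fill_closure_mono: "i \<le> i' \<Longrightarrow> fill_closure F K i \<subseteq> fill_closure F K i'"
  by (rule lift_Suc_mono_le[of "fill_closure F K"]) auto

lemma lang_combine_fill_closure:
  "X \<in> F \<Longrightarrow> B \<in> fill_closure F K i \<Longrightarrow> j \<le> K \<Longrightarrow>
    lang_combine (Ins j) X B \<in> fill_closure F K (Suc i)"
  by auto

lemma homogeneous_fill_closure:
  assumes "\<And>X. X \<in> F \<Longrightarrow> homogeneous X"
  shows "X \<in> fill_closure F K i \<Longrightarrow> homogeneous X"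
  by (induction i arbitrary: X) (auto simp: assms homogeneous_lang_combine_Ins)

declare fill_closure.simps(2) [simp del]

section \<open>Eliminating the top rank\<close>

locale rank_reduction =
  fixes F :: "'a word set set" and K c n :: nat
  assumes finite_family: "finite F"
    and homogeneous_family: "\<And>X. X \<in> F \<Longrightarrow> homogeneous X"
    and pumpable_lower: "\<And>X w. derivable (fill_closure F K (Suc (card F))) c K X w \<Longrightarrow>
      n < length w \<Longrightarrow> pumpable K n X w"
begin

definition bound :: "nat \<Rightarrow> nat" where
  "bound s = 2 ^ s * (n + c)"

abbreviation lower :: "'a word set \<Rightarrow> 'a word \<Rightarrow> bool" where
  "lower \<equiv> derivable (fill_closure F K (Suc (card F))) c K"

abbreviation pump :: "'a word set \<Rightarrow> 'a word \<Rightarrow> bool" where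
  "pump \<equiv> pumpable (Suc K) (bound (Suc (card F)))"

text \<open>Pushing a filling down through a region of height \<open>s\<close> costs up to \<open>s\<close> further
  intercalations, and a filling language of level \<open>i\<close> has already used \<open>i\<close> of them.\<close>

definition fillable :: "nat \<Rightarrow> 'a word set \<Rightarrow> 'a word \<Rightarrow> bool" where
  "fillable s X w \<longleftrightarrow> (\<forall>i j B b. 1 \<le> j \<longrightarrow> j \<le> rank_w w \<longrightarrow> B \<in> fill_closure F K i \<longrightarrow>
     i + s \<le> card F \<longrightarrow> lower B b \<longrightarrow> rank_w b = 0 \<longrightarrow>
     lower (lang_combine (Ins j) X B) (intercal j w b))"

text \<open>The connected region of nodes of rank \<open>K\<close> at the root of the derivation of \<open>w\<close> has
  height at most \<open>card S\<close>: \<open>S\<close> consists of the languages on a longest path through it, and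
  these are distinct.\<close>

definition tame :: "'a word set set \<Rightarrow> 'a word set \<Rightarrow> 'a word \<Rightarrow> bool" where
  "tame S X w \<longleftrightarrow> S \<subseteq> F \<and> length w \<le> bound (card S) \<and>
     (\<forall>Y\<in>S. \<exists>u. embeds_evenly K Y u X w) \<and> fillable (card S) X w \<and>
     (rank_w w < K \<longrightarrow> lower X w)"

lemma bound_mono: "s \<le> s' \<Longrightarrow> bound s \<le> bound s'"
  by (simp add: bound_def power_increasing)

lemma tame_card_le: "tame S X w \<Longrightarrow> card S \<le> card F"
  unfolding tame_def by (simp add: card_mono finite_family)

lemma fill_closure_subset_lower:
  "i \<le> Suc (card F) \<Longrightarrow> B \<in> fill_closure F K i \<Longrightarrow> B \<in> fill_closure F K (Suc (card F))"
  using fill_closure_mono by blast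

lemma family_subset_lower: "X \<in> F \<Longrightarrow> X \<in> fill_closure F K (Suc (card F))"
  using fill_closure_subset_lower[of 0] by simp

lemma lang_combine_Ins_lower:
  assumes "X \<in> F" "B \<in> fill_closure F K i" "j \<le> K" "i \<le> card F"
  shows "lang_combine (Ins j) X B \<in> fill_closure F K (Suc (card F))"
  using assms fill_closure_subset_lower[of "Suc i"] lang_combine_fill_closure by blast

lemma fillableI:
  assumes "\<And>i j B b. 1 \<le> j \<Longrightarrow> j \<le> rank_w w \<Longrightarrow> B \<in> fill_closure F K i \<Longrightarrow> i + s \<le> card F \<Longrightarrow>
    lower B b \<Longrightarrow> rank_w b = 0 \<Longrightarrow> lower (lang_combine (Ins j) X B) (intercal j w b)"
  shows "fillable s X w"
  using assms unfolding fillable_def by blast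

lemma fillableD:
  "fillable s X w \<Longrightarrow> 1 \<le> j \<Longrightarrow> j \<le> rank_w w \<Longrightarrow> B \<in> fill_closure F K i \<Longrightarrow> i + s \<le> card F \<Longrightarrow>
    lower B b \<Longrightarrow> rank_w b = 0 \<Longrightarrow> lower (lang_combine (Ins j) X B) (intercal j w b)"
  unfolding fillable_def by blast

lemma pump_or_tame_lower:
  assumes family: "X \<in> F" and lower: "lower X w"
  shows "pump X w \<or> tame {} X w"
proof (cases "n < length w")
  case True
  then have "pumpable K n X w" by (rule pumpable_lower[OF lower])
  moreover have "n \<le> bound 0" by (simp add: bound_def)
  then have "n \<le> bound (Suc (card F))" using bound_mono[OF le0] by (rule order_trans)
  ultimately show ?thesis using pumpable_mono[of K n X w "Suc K"] by simp
next
  case False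
  have "fillable 0 X w"
  proof (rule fillableI)
    fix i j B b
    assume gap: "1 \<le> j" "j \<le> rank_w w"
      and filling: "B \<in> fill_closure F K i" "i + 0 \<le> card F" "lower B b" "rank_w b = 0"
    have "j \<le> K" using gap(2) derivableD(3)[OF lower] by simp
    then have "lang_combine (Ins j) X B \<in> fill_closure F K (Suc (card F))"
      by (rule lang_combine_Ins_lower[OF family filling(1)]) (use filling(2) in simp)
    then have "lower (lang_combine (Ins j) X B) (combine (Ins j) w b)"
      by (rule derivable_combine[OF _ order_refl lower filling(3)])
        (use gap filling(4) derivableD(3)[OF lower] rank_w_intercal[OF gap, of b] in auto)
    then show "lower (lang_combine (Ins j) X B) (intercal j w b)" by simp
  qed
  then show ?thesis using False lower by (simp add: tame_def bound_def)
qed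

lemma pump_or_tame_insert:
  assumes family: "X \<in> F" and member: "w \<in> X" and rank: "rank_w w = K"
    and length: "length w \<le> bound (Suc (card S))"
    and path: "S \<subseteq> F" "\<And>Y. Y \<in> S \<Longrightarrow> \<exists>u. embeds_evenly K Y u X w \<and> length u < length w"
    and fillable: "fillable (Suc (card S)) X w"
  shows "pump X w \<or> tame (insert X S) X w"
proof (cases "X \<in> S")
  case True
  then have "pumpable (Suc K) (length w) X w" using path(2) pumpable_embeds_evenly by blast
  moreover have "length w \<le> bound (Suc (card F))"
    using length bound_mono[of "Suc (card S)" "Suc (card F)"] card_mono[OF finite_family path(1)] by simp
  ultimately show ?thesis using pumpable_mono by blast
next
  case False
  have "finite S" using path(1) finite_family finite_subset by blast
  then have "card (insert X S) = Suc (card S)" using False by simp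
  then show ?thesis
    using family length path fillable rank embeds_evenly_refl[OF rank member] unfolding tame_def by auto
qed

lemma pump_or_tame_leaf:
  assumes family: "X \<in> F"
    and leaf: "w \<in> X" "length w \<le> c" "rank_w w = 0 \<or> w = [Sep]" "rank_w w \<le> K"
  shows "pump X w \<or> (\<exists>S. tame S X w)"
proof (cases "rank_w w < K")
  case True
  then have "lower X w" using family leaf family_subset_lower by (auto intro: derivable.leaf)
  then show ?thesis using pump_or_tame_lower family by blast
next
  case False
  have "fillable 1 X w"
  proof (rule fillableI)
    fix i j B b
    assume gap: "1 \<le> j" "j \<le> rank_w w"
      and filling: "B \<in> fill_closure F K i" "i + 1 \<le> card F" "lower B b" "rank_w b = 0"
    have only_gap: "w = [Sep]" "j = 1" using gap leaf(3) by auto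
    have "lang_combine (Ins j) X B \<in> fill_closure F K (Suc (card F))"
      by (rule lang_combine_Ins_lower[OF family filling(1)]) (use filling(2) gap leaf(4) in auto)
    moreover have "B \<subseteq> lang_combine (Ins j) X B"
      using lang_combineI[OF leaf(1), of _ B "Ins j"] only_gap by auto
    ultimately show "lower (lang_combine (Ins j) X B) (intercal j w b)"
      using derivable_mono[OF filling(3)] only_gap by simp
  qed
  moreover have "length w \<le> bound 1" using leaf(2) by (simp add: bound_def)
  ultimately show ?thesis using pump_or_tame_insert[of X w "{}"] family leaf False by auto
qed

context
  fixes X Y Z f u v S T
  assumes X_in_family: "X \<in> F" and production: "lang_combine f Y Z \<subseteq> X"
    and derivable_u: "derivable F c (Suc K) Y u" and derivable_v: "derivable F c (Suc K) Z v"
    and admissible: "admissible f (rank_w u)"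
    and u_nontrivial: "u \<noteq> neutral f" and v_nontrivial: "v \<noteq> neutral f"
    and rank_node: "rank_w (combine f u v) \<le> K"
    and tame_u: "tame S Y u" and tame_v: "tame T Z v"
begin

lemma u_in_Y: "u \<in> Y" and v_in_Z: "v \<in> Z"
  using derivable_u derivable_v by (simp_all add: derivableD(2))

lemma lower_u: "rank_w u < K \<Longrightarrow> lower Y u" and lower_v: "rank_w v < K \<Longrightarrow> lower Z v"
  using tame_u tame_v unfolding tame_def by blast+

lemma fillable_u: "fillable (card S) Y u" and fillable_v: "fillable (card T) Z v"
  using tame_u tame_v unfolding tame_def by blast+

lemma lower_fill_left:
  assumes filling: "B \<in> fill_closure F K h" "h + card S \<le> card F" "lower B b" "rank_w b = 0"
    and gap: "1 \<le> i" "i \<le> rank_w u"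
    and target: "X' \<in> fill_closure F K (Suc (card F))"
      "lang_combine g (lang_combine (Ins i) Y B) Z \<subseteq> X'"
    and result: "admissible g (rank_w (intercal i u b))" "rank_w (combine g (intercal i u b) v) < K"
  shows "lower X' (combine g (intercal i u b) v)"
proof -
  have "rank_w v < K" using rank_w_le_combine_right[OF result(1)] result(2) by (rule le_less_trans)
  moreover have "lower (lang_combine (Ins i) Y B) (intercal i u b)"
    by (rule fillableD[OF fillable_u gap filling])
  ultimately show ?thesis using derivable_combine[OF target _ _ result] lower_v by blast
qed

lemma lower_fill_right:
  assumes filling: "B \<in> fill_closure F K h" "h + Suc (max (card S) (card T)) \<le> card F"
      "lower B b" "rank_w b = 0"
    and gap: "1 \<le> i" "i \<le> rank_w v"
    and target: "X' \<in> fill_closure F K (Suc (card F))"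
      "lang_combine f Y (lang_combine (Ins i) Z B) \<subseteq> X'"
    and result: "rank_w (combine f u (intercal i v b)) < K"
  shows "lower X' (combine f u (intercal i v b))"
proof -
  have v_filled: "lower (lang_combine (Ins i) Z B) (intercal i v b)"
    by (rule fillableD[OF fillable_v gap filling(1) _ filling(3,4)]) (use filling(2) in simp)
  show ?thesis
  proof (cases "rank_w u < K")
    case True
    then show ?thesis using derivable_combine[OF target lower_u v_filled admissible result] by blast
  next
    case False
    then obtain m where Ins: "f = Ins m" and rank_v: "rank_w v = 1"
      using rank_w_combine[OF admissible, of v] rank_node gap derivableD(3)[OF derivable_u]
      by (cases f) auto
    then have "rank_w (intercal i v b) = 0"
      using rank_w_intercal[OF gap, of b] filling(4) by simp
    moreover have "lang_combine (Ins i) Z B \<in> fill_closure F K (Suc h)"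
      using lang_combine_fill_closure[OF derivableD(1)[OF derivable_v] filling(1)] gap(2) rank_v
        derivableD(3)[OF derivable_v] by simp
    ultimately have
      "lower (lang_combine f Y (lang_combine (Ins i) Z B)) (combine f u (intercal i v b))"
      using fillableD[OF fillable_u _ _ _ _ v_filled] Ins admissible filling(2) by simp
    then show ?thesis by (rule derivable_mono[OF _ target(2,1)])
  qed
qed

lemma fillable_node: "fillable (Suc (max (card S) (card T))) X (combine f u v)"
proof (rule fillableI)
  fix h j B b
  assume gap: "1 \<le> j" "j \<le> rank_w (combine f u v)"
    and filling: "B \<in> fill_closure F K h" "h + Suc (max (card S) (card T)) \<le> card F"
      "lower B b" "rank_w b = 0"
  have target: "lang_combine (Ins j) X B \<in> fill_closure F K (Suc (card F))"
    by (rule lang_combine_Ins_lower[OF X_in_family filling(1)])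
      (use filling(2) gap rank_node in auto)
  have result: "rank_w (intercal j (combine f u v) b) < K"
    using rank_w_intercal[OF gap, of b] filling(4) rank_node by simp
  have "homogeneous Y" "homogeneous Z" "homogeneous B"
    using derivableD(1) derivable_u derivable_v filling(1)
      homogeneous_family homogeneous_fill_closure by blast+
  then show "lower (lang_combine (Ins j) X B) (intercal j (combine f u v) b)"
    using u_in_Y v_in_Z derivableD(2)[OF filling(3)] filling(4) production admissible gap
  proof (cases rule: fill_combine_cases)
    case (left g i)
    then show ?thesis
      using lower_fill_left[OF filling(1) _ filling(3,4) left(1,2) target left(5,3)]
        filling(2) result by simp
  next
    case (right i)
    then show ?thesis using lower_fill_right[OF filling right(1,2) target right(4)] result by simp
  qed
qed

lemma lower_node:
  assumes "rank_w (combine f u v) < K"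
  shows "lower X (combine f u v)"
proof -
  have "rank_w v < K" using rank_w_le_combine_right[OF admissible] assms by (rule le_less_trans)
  then have lower_Z_v: "lower Z v" by (rule lower_v)
  show ?thesis
  proof (cases "rank_w u < K")
    case True
    show ?thesis
      by (rule derivable_combine[OF family_subset_lower[OF X_in_family] production lower_u[OF True]
            lower_Z_v admissible assms])
  next
    case False
    then obtain m where "f = Ins m" "rank_w v = 0"
      using rank_w_combine[OF admissible, of v] assms by (cases f) auto
    then have "lower (lang_combine f Y Z) (combine f u v)"
      using fillableD[OF fillable_u, of m Z 0 v] tame_card_le[OF tame_u] admissible lower_Z_v
        derivableD(1)[OF derivable_v] by simp
    then show ?thesis by (rule derivable_mono[OF _ production family_subset_lower[OF X_in_family]])
  qed
qed

lemma node_embeds_path: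
  assumes rank: "rank_w (combine f u v) = K" and path: "W \<in> S \<or> W \<in> T"
  shows "\<exists>x. embeds_evenly K W x X (combine f u v) \<and> length x < length (combine f u v)"
  using path
proof
  assume "W \<in> S"
  then obtain x where x_in_u: "embeds_evenly K W x Y u" using tame_u unfolding tame_def by blast
  then have "rank_w u = K" by (rule rank_w_embeds_evenly)
  then have "embeds_evenly K Y u X (combine f u v)" "length u < length (combine f u v)"
    using embeds_evenly_combine_left[OF production u_in_Y v_in_Z admissible]
      length_less_combine_left[OF admissible] v_nontrivial rank by auto
  then show ?thesis
    using x_in_u embeds_evenly_trans length_embeds_evenly le_less_trans by blast
next
  assume "W \<in> T"
  then obtain x where x_in_v: "embeds_evenly K W x Z v" using tame_v unfolding tame_def by blast
  then have "rank_w v = K" by (rule rank_w_embeds_evenly)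
  then have "embeds_evenly K Z v X (combine f u v)" "length v < length (combine f u v)"
    using embeds_evenly_combine_right[OF production u_in_Y v_in_Z admissible]
      length_less_combine_right[OF admissible] u_nontrivial rank by auto
  then show ?thesis
    using x_in_v embeds_evenly_trans length_embeds_evenly le_less_trans by blast
qed

lemma length_node_le: "length (combine f u v) \<le> bound (Suc (max (card S) (card T)))"
proof -
  let ?s = "max (card S) (card T)"
  have "length (combine f u v) \<le> length u + length v"
    using length_combine[OF admissible, of v] by simp
  also have "\<dots> \<le> bound (card S) + bound (card T)"
    using tame_u tame_v unfolding tame_def by (intro add_mono) auto
  also have "\<dots> \<le> bound ?s + bound ?s" by (intro add_mono bound_mono) auto
  finally show ?thesis by (simp add: bound_def)
qed

lemma pump_or_tame_node: "pump X (combine f u v) \<or> (\<exists>R. tame R X (combine f u v))"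
proof (cases "rank_w (combine f u v) < K")
  case True
  then show ?thesis using pump_or_tame_lower[OF X_in_family] lower_node by blast
next
  case False
  then have rank: "rank_w (combine f u v) = K" using rank_node by simp
  obtain R where longer: "R = S \<or> R = T" "card R = max (card S) (card T)" by (metis max_def)
  have "R \<subseteq> F" using longer(1) tame_u tame_v unfolding tame_def by blast
  moreover have "combine f u v \<in> X" by (rule subsetD[OF production lang_combineI[OF u_in_Y v_in_Z]])
  moreover have "\<exists>x. embeds_evenly K W x X (combine f u v) \<and> length x < length (combine f u v)"
    if "W \<in> R" for W
    by (rule node_embeds_path[OF rank]) (use that longer(1) in blast)
  ultimately show ?thesis
    using pump_or_tame_insert[OF X_in_family _ rank, of R] length_node_le fillable_node longer(2) by auto
qed

end

lemma pump_or_tame: "derivable F c (Suc K) X w \<Longrightarrow> pump X w \<or> (\<exists>S. tame S X w)"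
proof (induction rule: derivable.induct)
  case (leaf X w)
  then show ?case by (intro pump_or_tame_leaf) auto
next
  case (node X Y u Z v f)
  show ?case
  proof (cases "pump Y u \<or> pump Z v")
    case True
    then show ?thesis using pumpable_combine[of f Y Z X u v] node.hyps derivableD(2) by blast
  next
    case False
    then obtain S T where "tame S Y u" "tame T Z v" using node.IH by blast
    then show ?thesis
      using pump_or_tame_node[of X f Y Z u v S T] node.hyps by simp
  qed
qed

lemma pumpable_if_bound_less:
  assumes "derivable F c (Suc K) X w" "bound (Suc (card F)) < length w"
  shows "pump X w"
proof (rule ccontr)
  assume "\<not> pump X w"
  then obtain S where tame: "tame S X w" using pump_or_tame assms(1) by blast
  then have "length w \<le> bound (card S)" unfolding tame_def by blast
  also have "\<dots> \<le> bound (Suc (card F))" using tame_card_le[OF tame] by (intro bound_mono) simp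
  finally show False using assms(2) by simp
qed

end

theorem derivable_pumpable:
  assumes "finite F" "\<And>X. X \<in> F \<Longrightarrow> homogeneous X"
  shows "\<exists>n. \<forall>X w. derivable F c K X w \<longrightarrow> n < length w \<longrightarrow> pumpable K n X w"
  using assms
proof (induction K arbitrary: F)
  case 0
  have "\<not> derivable F c 0 X w" for X w using derivableD(3)[of F c 0 X w] by auto
  then show ?case by simp
next
  case (Suc K)
  let ?F' = "fill_closure F K (Suc (card F))"
  obtain n where pumpable: "\<And>X w. derivable ?F' c K X w \<Longrightarrow> n < length w \<Longrightarrow> pumpable K n X w"
    using Suc.IH[of ?F'] Suc.prems finite_fill_closure homogeneous_fill_closure by metis
  interpret rank_reduction F K c n
    by (rule rank_reduction.intro[OF Suc.prems pumpable])
  show ?case using pumpable_if_bound_less by blast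
qed

section \<open>Displacement context-free grammars\<close>

inductive generates :: "('n \<times> ('n, 'a) tm) set \<Rightarrow> ('n, 'a) tm \<Rightarrow> 'a word \<Rightarrow> bool"
  for P where
  expand: "(A, \<alpha>) \<in> P \<Longrightarrow> generates P \<alpha> w \<Longrightarrow> generates P (NT A) w"
| terminals: "generates P (Wd x) (map Sy x)"
| separator: "generates P One [Sep]"
| conc: "generates P a u \<Longrightarrow> generates P b v \<Longrightarrow> generates P (Conc a b) (u @ v)"
| intc: "generates P a u \<Longrightarrow> generates P b v \<Longrightarrow> generates P (Intc j a b) (intercal j u v)"

abbreviation term_lang :: "('n \<times> ('n, 'a) tm) set \<Rightarrow> ('n, 'a) tm \<Rightarrow> 'a word set" where
  "term_lang P a \<equiv> Collect (generates P a)"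

lemma generates_val: "ground a \<Longrightarrow> generates P a (val a)"
  by (induction a) (auto intro: generates.intros)

lemma generates_step: "step P a b \<Longrightarrow> generates P b w \<Longrightarrow> generates P a w"
  by (induction arbitrary: w rule: step.induct)
    (auto intro: generates.expand
      elim!: generates.cases[of _ "Conc _ _"] generates.cases[of _ "Intc _ _ _"]
      intro!: generates.conc generates.intc)

lemma generates_steps: "(step P)\<^sup>*\<^sup>* a b \<Longrightarrow> generates P b w \<Longrightarrow> generates P a w"
  by (induction rule: converse_rtranclp_induct) (auto intro: generates_step)

lemma rtranclp_map: "r\<^sup>*\<^sup>* a b \<Longrightarrow> (\<And>a b. r a b \<Longrightarrow> q (h a) (h b)) \<Longrightarrow> q\<^sup>*\<^sup>* (h a) (h b)"
  by (induction rule: rtranclp_induct) (auto intro: rtranclp.rtrancl_into_rtrancl)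

lemma steps_Conc:
  assumes "(step P)\<^sup>*\<^sup>* a a'" "(step P)\<^sup>*\<^sup>* b b'"
  shows "(step P)\<^sup>*\<^sup>* (Conc a b) (Conc a' b')"
proof -
  have "(step P)\<^sup>*\<^sup>* (Conc a b) (Conc a' b)"
    using assms(1) by (rule rtranclp_map) (rule step.concL)
  also have "(step P)\<^sup>*\<^sup>* (Conc a' b) (Conc a' b')"
    using assms(2) by (rule rtranclp_map) (rule step.concR)
  finally show ?thesis .
qed

lemma steps_Intc:
  assumes "(step P)\<^sup>*\<^sup>* a a'" "(step P)\<^sup>*\<^sup>* b b'"
  shows "(step P)\<^sup>*\<^sup>* (Intc j a b) (Intc j a' b')"
proof -
  have "(step P)\<^sup>*\<^sup>* (Intc j a b) (Intc j a' b)"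
    using assms(1) by (rule rtranclp_map) (rule step.intcL)
  also have "(step P)\<^sup>*\<^sup>* (Intc j a' b) (Intc j a' b')"
    using assms(2) by (rule rtranclp_map) (rule step.intcR)
  finally show ?thesis .
qed

lemma generates_imp_steps: "generates P a w \<Longrightarrow> \<exists>b. ground b \<and> (step P)\<^sup>*\<^sup>* a b \<and> val b = w"
proof (induction rule: generates.induct)
  case (expand A \<alpha> w)
  then show ?case by (metis step.rule converse_rtranclp_into_rtranclp)
next
  case (terminals x)
  then show ?case by (intro exI[of _ "Wd x"]) simp
next
  case separator
  then show ?case by (intro exI[of _ One]) simp
next
  case (conc a u b v)
  then show ?case using steps_Conc by (metis ground.simps(4) val.simps(4))
next
  case (intc a u b v j)
  then show ?case using steps_Intc by (metis ground.simps(5) val.simps(5))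
qed

lemma lang_iff_generates: "w \<in> lang G \<longleftrightarrow> map Sy w \<in> term_lang (Rules G) (NT (Start G))"
proof
  assume "w \<in> lang G"
  then obtain a where "ground a" "(step (Rules G))\<^sup>*\<^sup>* (NT (Start G)) a" "val a = map Sy w"
    unfolding lang_def derives_def by blast
  then show "map Sy w \<in> term_lang (Rules G) (NT (Start G))"
    using generates_steps generates_val by (metis mem_Collect_eq)
next
  assume "map Sy w \<in> term_lang (Rules G) (NT (Start G))"
  then show "w \<in> lang G" using generates_imp_steps unfolding lang_def derives_def by blast
qed

fun subterms :: "('n, 'a) tm \<Rightarrow> ('n, 'a) tm set" where
  "subterms (Conc a b) = insert (Conc a b) (subterms a \<union> subterms b)"
| "subterms (Intc j a b) = insert (Intc j a b) (subterms a \<union> subterms b)"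
| "subterms a = {a}"

lemma finite_subterms: "finite (subterms a)"
  by (induction a rule: subterms.induct) auto

lemma subterms_refl: "a \<in> subterms a"
  by (cases a) auto

lemma subterms_trans: "b \<in> subterms a \<Longrightarrow> subterms b \<subseteq> subterms a"
  by (induction a rule: subterms.induct) auto

lemma correct_subterms: "correct k N rk a \<Longrightarrow> b \<in> subterms a \<Longrightarrow> correct k N rk b"
  by (induction a rule: subterms.induct) auto

lemma trk_le_max: "\<forall>A\<in>N. rk A \<le> k \<Longrightarrow> correct k N rk a \<Longrightarrow> trk rk a \<le> max k 1"
  by (induction a) force+

lemma trk_subterms_le:
  assumes "\<forall>A\<in>N. rk A \<le> k" "correct k N rk a" "trk rk a \<le> k" "b \<in> subterms a"
  shows "trk rk b \<le> k"
  using assms(2-4)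
proof (induction a rule: subterms.induct)
  case (2 j a b)
  then have "trk rk a \<le> k" "trk rk b \<le> k" using trk_le_max[OF assms(1), of a] by auto
  then show ?case using 2 by auto
qed auto

locale displacement_grammar =
  fixes k :: nat and G :: "('n, 'a) dcfg"
  assumes is_dcfg: "is_dcfg k G"
begin

definition grammar_terms :: "('n, 'a) tm set" where
  "grammar_terms = NT ` Nts G \<union> (\<Union>(A, \<alpha>)\<in>Rules G. subterms \<alpha>)"

abbreviation term_langs :: "'a word set set" where
  "term_langs \<equiv> term_lang (Rules G) ` grammar_terms"

lemma rank_le: "\<forall>A\<in>Nts G. rank G A \<le> k"
  using is_dcfg by (simp add: is_dcfg_def)

lemma ruleD:
  assumes "(A, \<alpha>) \<in> Rules G"
  shows "A \<in> Nts G" "correct k (Nts G) (rank G) \<alpha>" "trk (rank G) \<alpha> = rank G A"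
  using is_dcfg assms unfolding is_dcfg_def by fastforce+

lemma finite_grammar_terms: "finite grammar_terms"
  using is_dcfg unfolding grammar_terms_def is_dcfg_def by (auto simp: finite_subterms)

lemma Start_in_grammar_terms: "NT (Start G) \<in> grammar_terms"
  using is_dcfg by (simp add: grammar_terms_def is_dcfg_def)

lemma subterms_subset_grammar_terms: "a \<in> grammar_terms \<Longrightarrow> subterms a \<subseteq> grammar_terms"
  using subterms_trans[of a] unfolding grammar_terms_def by auto

lemma rule_in_grammar_terms: "(A, \<alpha>) \<in> Rules G \<Longrightarrow> \<alpha> \<in> grammar_terms"
  using subterms_refl unfolding grammar_terms_def by auto

lemma grammar_terms_correct:
  assumes "a \<in> grammar_terms"
  shows "correct k (Nts G) (rank G) a" "trk (rank G) a \<le> k"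
proof -
  from assms consider (nonterminals) A where "A \<in> Nts G" "a = NT A"
    | (rhs) A \<alpha> where "(A, \<alpha>) \<in> Rules G" "a \<in> subterms \<alpha>"
    unfolding grammar_terms_def by auto
  then have "correct k (Nts G) (rank G) a \<and> trk (rank G) a \<le> k"
  proof cases
    case rhs
    then show ?thesis
      using correct_subterms trk_subterms_le[OF rank_le] ruleD rank_le by metis
  qed (use rank_le in simp)
  then show "correct k (Nts G) (rank G) a" "trk (rank G) a \<le> k" by blast+
qed

lemma rank_w_generates:
  assumes "generates (Rules G) a w" "correct k (Nts G) (rank G) a"
  shows "rank_w w = trk (rank G) a"
  using assms
proof (induction rule: generates.induct)
  case (expand A \<alpha> w)
  then show ?case using ruleD by simp
next
  case (intc a u b v j)
  then show ?case using rank_w_intercal[of j u v] by auto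
qed auto

lemma rank_w_generates_le:
  "generates (Rules G) a w \<Longrightarrow> a \<in> grammar_terms \<Longrightarrow> rank_w w \<le> k"
  using rank_w_generates grammar_terms_correct by metis

lemma homogeneous_term_langs: "X \<in> term_langs \<Longrightarrow> homogeneous X"
  unfolding homogeneous_def using rank_w_generates grammar_terms_correct(1) by auto

lemma derivable_generates:
  assumes leaf_bound: "1 \<le> c" "\<And>x. Wd x \<in> grammar_terms \<Longrightarrow> length x \<le> c"
  shows "generates (Rules G) a w \<Longrightarrow> a \<in> grammar_terms \<Longrightarrow>
    derivable term_langs c (Suc k) (term_lang (Rules G) a) w"
proof (induction rule: generates.induct)
  case (expand A \<alpha> w)
  have "term_lang (Rules G) \<alpha> \<subseteq> term_lang (Rules G) (NT A)"
    using expand.hyps(1) by (auto intro: generates.expand)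
  then show ?case
    using derivable_mono expand rule_in_grammar_terms by blast
next
  case (terminals x)
  then show ?case using leaf_bound(2) by (intro derivable.leaf) (auto intro: generates.terminals)
next
  case separator
  then show ?case
    using leaf_bound(1) rank_w_generates_le[OF generates.separator]
    by (intro derivable.leaf) (auto intro: generates.separator)
next
  case (conc a u b v)
  have subterms: "a \<in> grammar_terms" "b \<in> grammar_terms"
    using subterms_subset_grammar_terms[OF conc.prems] subterms_refl by auto
  have "lang_combine Cat (term_lang (Rules G) a) (term_lang (Rules G) b)
      \<subseteq> term_lang (Rules G) (Conc a b)"
    by (auto simp: lang_combine_def intro: generates.conc)
  from derivable_combine[OF _ this conc.IH(1)[OF subterms(1)] conc.IH(2)[OF subterms(2)]]
  show ?case
    using conc.prems rank_w_generates_le[OF generates.conc[OF conc.hyps] conc.prems] by simp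
next
  case (intc a u b v j)
  have subterms: "a \<in> grammar_terms" "b \<in> grammar_terms"
    using subterms_subset_grammar_terms[OF intc.prems] subterms_refl by auto
  have admissible: "admissible (Ins j) (rank_w u)"
    using grammar_terms_correct(1)[OF intc.prems] rank_w_generates[OF intc.hyps(1)] by auto
  have "lang_combine (Ins j) (term_lang (Rules G) a) (term_lang (Rules G) b)
      \<subseteq> term_lang (Rules G) (Intc j a b)"
    by (auto simp: lang_combine_def intro: generates.intc)
  from derivable_combine[OF _ this intc.IH(1)[OF subterms(1)] intc.IH(2)[OF subterms(2)] admissible]
  show ?case
    using intc.prems rank_w_generates_le[OF generates.intc[OF intc.hyps] intc.prems] by simp
qed

lemma pumpable_generates:
  "\<exists>n. \<forall>a w. a \<in> grammar_terms \<longrightarrow> generates (Rules G) a w \<longrightarrow> n < length w \<longrightarrow>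
    pumpable (Suc k) n (term_lang (Rules G) a) w"
proof -
  have "finite (length ` (Wd -` grammar_terms))"
    by (simp add: finite_grammar_terms finite_vimageI inj_def)
  then obtain c where leaf_bound: "\<And>x. Wd x \<in> grammar_terms \<Longrightarrow> length x \<le> c"
    unfolding finite_nat_set_iff_bounded_le by auto
  obtain n where "\<And>X w. derivable term_langs (Suc c) (Suc k) X w \<Longrightarrow> n < length w \<Longrightarrow>
      pumpable (Suc k) n X w"
    using derivable_pumpable[OF finite_imageI[OF finite_grammar_terms] homogeneous_term_langs]
    by blast
  then show ?thesis using derivable_generates[of "Suc c"] leaf_bound le_SucI
    by (metis le_add1 plus_1_eq_Suc)
qed

end

section \<open>The pumping lemma\<close>

lemma map_eq_map_nth_from_1:
  assumes "\<And>i. i < length xs \<Longrightarrow> g (Suc i) = f (xs ! i)"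
  shows "map g [1..<length xs + 1] = map f xs"
  by (rule nth_equalityI) (auto simp: assms simp del: upt_Suc)

lemma loop_length_core: "loop_length (core bs) = length (concat (map (\<lambda>(y, u, z, s). y @ z) bs))"
  by (induction bs rule: core.induct) (auto simp: loop_length_def)

lemma window_length_core:
  "window_length (core bs) = length (concat (map (\<lambda>(y, u, z, s). y @ u @ z) bs))"
  by (induction bs rule: core.induct) (auto simp: window_length_def)

lemma letters_pumped:
  "letters (pumped p t bs) =
    letters t @ concat (map (\<lambda>(y, u, z, s). pow p y @ u @ pow p z @ letters s) bs)"
  by (induction p t bs rule: pumped.induct) auto

definition pumps_in :: "'a list set \<Rightarrow> nat \<Rightarrow> 'a list \<Rightarrow> nat \<Rightarrow>
    (nat \<Rightarrow> 'a list) \<Rightarrow> (nat \<Rightarrow> 'a list) \<Rightarrow> (nat \<Rightarrow> 'a list) \<Rightarrow> (nat \<Rightarrow> 'a list) \<Rightarrow> bool" where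
  "pumps_in L n w l s y u z \<longleftrightarrow>
     w = s 0 @ concat (map (\<lambda>i. y i @ u i @ z i @ s i) [1..<l+1]) \<and>
     length (concat (map (\<lambda>i. y i @ z i) [1..<l+1])) > 0 \<and>
     length (concat (map (\<lambda>i. y i @ u i @ z i) [1..<l+1])) \<le> n \<and>
     (\<forall>p. s 0 @ concat (map (\<lambda>i. pow p (y i) @ u i @ pow p (z i) @ s i) [1..<l+1]) \<in> L)"

lemma pumpable_map_SyD:
  assumes "pumpable l n X (map Sy w)"
  shows "\<exists>l' \<le> l. \<exists>s y u z. pumps_in {x. map Sy x \<in> X} n w l' s y u z"
proof -
  obtain t bs where blocks: "length bs \<le> l" "map Sy w = pumped 1 t bs" "0 < loop_length (core bs)"
    "window_length (core bs) \<le> n" "\<And>p. pumped p t bs \<in> X"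
    using assms unfolding pumpable_def by blast
  define s where "s = case_nat (letters t) (\<lambda>i. letters (snd (snd (snd (bs ! i)))))"
  define y u z where "y i = fst (bs ! (i - 1))" and "u i = fst (snd (bs ! (i - 1)))"
    and "z i = fst (snd (snd (bs ! (i - 1))))" for i
  note components = s_def y_def u_def z_def case_prod_beta
  have letters: "letters (pumped p t bs) =
      s 0 @ concat (map (\<lambda>i. pow p (y i) @ u i @ pow p (z i) @ s i) [1..<length bs + 1])" for p
    unfolding letters_pumped
    by (subst map_eq_map_nth_from_1[where xs = bs]) (auto simp: components)
  have "rank_w (pumped p t bs) = 0" for p
    using rank_w_pumped[of p t bs 1] blocks(2)[symmetric] by simp
  then have "map Sy (letters (pumped p t bs)) \<in> X" for p using blocks(5) by (simp add: map_Sy_letters)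
  moreover have "w = s 0 @ concat (map (\<lambda>i. y i @ u i @ z i @ s i) [1..<length bs + 1])"
    using letters[of 1] blocks(2)[symmetric] by simp
  moreover have "loop_length (core bs) = length (concat (map (\<lambda>i. y i @ z i) [1..<length bs + 1]))"
    unfolding loop_length_core
    by (subst map_eq_map_nth_from_1[where xs = bs]) (auto simp: components)
  moreover have "window_length (core bs) =
      length (concat (map (\<lambda>i. y i @ u i @ z i) [1..<length bs + 1]))"
    unfolding window_length_core
    by (subst map_eq_map_nth_from_1[where xs = bs]) (auto simp: components)
  ultimately have "pumps_in {x. map Sy x \<in> X} n w (length bs) s y u z"
    using blocks(3,4) unfolding pumps_in_def letters mem_Collect_eq
    by (intro conjI allI) (simp_all only:)
  then show ?thesis using blocks(1) by blast
qed

theorem theorem3: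
  fixes G :: "('n, 'a) dcfg" and k :: nat
  assumes "is_dcfg k G"
  shows "\<exists>n. \<forall>w \<in> lang G. length w > n \<longrightarrow>
    (\<exists>l \<le> k + 1. \<exists>s y u z :: nat \<Rightarrow> 'a list.
       w = s 0 @ concat (map (\<lambda>i. y i @ u i @ z i @ s i) [1..<l+1]) \<and>
       length (concat (map (\<lambda>i. y i @ z i) [1..<l+1])) > 0 \<and>
       length (concat (map (\<lambda>i. y i @ u i @ z i) [1..<l+1])) \<le> n \<and>
       (\<forall>p::nat. s 0 @ concat (map (\<lambda>i. concat (replicate p (y i)) @ u i @
                   concat (replicate p (z i)) @ s i) [1..<l+1]) \<in> lang G))"
proof -
  interpret displacement_grammar k G by (rule displacement_grammar.intro[OF assms])
  let ?L = "term_lang (Rules G) (NT (Start G))"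
  have lang: "lang G = {w. map Sy w \<in> ?L}" using lang_iff_generates by blast
  obtain n where "\<And>w. w \<in> ?L \<Longrightarrow> n < length w \<Longrightarrow> pumpable (k + 1) n ?L w"
    using pumpable_generates Start_in_grammar_terms by auto
  then have pumpable: "pumpable (k + 1) n ?L (map Sy w)" if "w \<in> lang G" "n < length w" for w
    using that by (simp add: lang)
  have "\<exists>l\<le>k + 1. \<exists>s y u z. pumps_in (lang G) n w l s y u z"
    if "w \<in> lang G" "n < length w" for w
    using pumpable_map_SyD[OF pumpable[OF that]] by (simp only: lang)
  then have "\<exists>n. \<forall>w\<in>lang G. n < length w \<longrightarrow>
      (\<exists>l\<le>k + 1. \<exists>s y u z. pumps_in (lang G) n w l s y u z)" by blast
  then show ?thesis unfolding pumps_in_def .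
qed

end
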